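(* Let $p,q>0$, $r\in\{0,1\}$, $a\in(0,1)$, let $T>0$, and let $\Omega\subset\mathbb{R}$ be a compact set. Let $v:\Omega\times[0,T]\to(v_-,v_+)$ be (the restriction to $\Omega\times[0,T]$ of) the traveling wave solution, with wave speed $c\in\mathbb{R}$ and equilibrium states $v_-\neq v_+$, of the scaled reaction-diffusion equation $$v_\tau = v_{\xi\xi} + v^p(1-v^q)(v-a)^r .$$ Let $\sigma:\mathbb{R}\to\mathbb{R}$ be a sigmoid function, and let $$\phi(s)=v_-+(v_+-v_-)\frac{1}{1+\exp(-s)},\qquad s\in\mathbb{R}.$$ Then for every $\varepsilon>0$ there exist a positive integer $N$, constants $a_i,b_i,c_i\in\mathbb{R}$ for $i=1,\dots,N$, and a predicted wave speed $\omega\in\mathbb{R}$ such that the function $$\hat v(\xi,\tau)=\phi\left(\sum_{i=1}^{N}c_i\,\sigma\big(a_i(\xi-\omega\tau)+b_i\big)\right)$$ satisfies $$|v(\xi,\tau)-\hat v(\xi,\tau)|<\varepsilon\qquad\text{for all }\xi\in\Omega,\ \tau\in[0,T].$$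
   Context: A sigmoid function is any bounded, differentiable function $\sigma:\mathbb{R}\to\mathbb{R}$ with strictly positive derivative everywhere. A traveling wave solution with wave speed $c$ is a solution of the form $v(\xi,\tau)=V(\xi-c\tau)$, where the profile $V:\mathbb{R}\to\mathbb{R}$ is a (twice differentiable) solution of the ordinary differential equation $$V''+cV'+V^p(1-V^q)(V-a)^r=0$$ on $\mathbb{R}$ that connects two equilibrium states $v_-,v_+$ (distinct real zeros of the reaction function $f(v)=v^p(1-v^q)(v-a)^r$), i.e. $\lim_{\zeta\to-\infty}V(\zeta)=v_-$ and $\lim_{\zeta\to\infty}V(\zeta)=v_+$, and $V$ takes values strictly between $v_-$ and $v_+$. The notation $(v_-,v_+)$ denotes the open interval with endpoints $v_-$ and $v_+$, regardless of which endpoint is larger (for example $(v_-,v_+)=(1,0)$ stands for the open interval from $0$ to $1$). It is understood that $f$ is real-valued on this interval. *)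

theory Defs
  imports "HOL-Analysis.Analysis"
begin

text \<open>
  Real powers \<open>x\<^sup>p\<close> with \<open>p > 0\<close>.  For \<open>x \<ge> 0\<close> this is \<open>powr\<close>, with value 0 at \<open>x = 0\<close>.
  For \<open>x < 0\<close> the power is real exactly if \<open>p = m / n\<close> with \<open>n\<close> odd (in particular for natural
  \<open>p\<close>), and is then the \<open>m\<close>-th power of the \<open>n\<close>-th root.  The library's real \<open>powr\<close> is not
  suitable for a negative base: it ignores the sign of the base.
\<close>

definition real_power_defined :: "real \<Rightarrow> real \<Rightarrow> bool" where
  "real_power_defined x p \<longleftrightarrow> 0 \<le> x \<or> (\<exists>m n :: nat. odd n \<and> p = real m / real n)"

definition real_power :: "real \<Rightarrow> real \<Rightarrow> real" where
  "real_power x p =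
    (if 0 \<le> x then x powr p
     else (THE y. \<exists>m n :: nat. odd n \<and> p = real m / real n \<and> y = root n x ^ m))"

text \<open>The description is independent of the chosen representation of the exponent.\<close>

lemma odd_root_power_unique:
  fixes x :: real and m n m' n' :: nat
  assumes "odd n" "odd n'" and eq: "real m / real n = real m' / real n'"
  shows "root n x ^ m = root n' x ^ m'"
proof -
  have pos: "n > 0" "n' > 0" using assms by (auto intro: odd_pos)
  have "real (m * n') = real (m' * n)"
    using eq pos by (simp add: field_simps)
  then have mn: "m * n' = m' * n" by (simp only: of_nat_eq_iff)
  have "(root n x ^ m) ^ (n * n') = (root n x ^ n) ^ (m * n')"
    by (simp add: power_mult[symmetric] ac_simps)
  also have "\<dots> = x ^ (m * n')" using assms(1) by (simp add: odd_real_root_pow)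
  also have "\<dots> = x ^ (m' * n)" by (simp only: mn)
  also have "\<dots> = (root n' x ^ n') ^ (m' * n)" using assms(2) by (simp add: odd_real_root_pow)
  also have "\<dots> = (root n' x ^ m') ^ (n * n')"
    by (simp add: power_mult[symmetric] ac_simps)
  finally have "(root n x ^ m) ^ (n * n') = (root n' x ^ m') ^ (n * n')" .
  moreover have "odd (n * n')" using assms by simp
  ultimately show ?thesis
    by (metis odd_real_root_power_cancel)
qed

lemma real_power_odd_denominator:
  fixes x :: real and m n :: nat
  assumes "odd n" "m > 0"
  shows "real_power x (real m / real n) = root n x ^ m"
proof (cases "x < 0")
  case True
  have "(THE y. \<exists>k l :: nat. odd l \<and> real m / real n = real k / real l \<and> y = root l x ^ k)
      = root n x ^ m"
    using assms by (intro the_equality) (auto intro: odd_root_power_unique[symmetric])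
  then show ?thesis using True by (simp add: real_power_def)
next
  case False
  have n: "n > 0" using assms by (auto intro: odd_pos)
  show ?thesis
  proof (cases "x = 0")
    case True
    then show ?thesis using assms by (simp add: real_power_def)
  next
    case nz: False
    then have "x > 0" using False by simp
    then show ?thesis
      using n by (simp add: real_power_def root_powr_inverse powr_powr flip: powr_realpow)
  qed
qed

lemma real_power_of_nat:
  fixes x :: real and m :: nat
  assumes "m > 0"
  shows "real_power x (real m) = x ^ m"
  using real_power_odd_denominator[of 1 m x] assms by simp

definition reaction :: "real \<Rightarrow> real \<Rightarrow> nat \<Rightarrow> real \<Rightarrow> real \<Rightarrow> real" where
  "reaction p q r a v = real_power v p * (1 - real_power v q) * (v - a) ^ r"

definition reaction_real :: "real \<Rightarrow> real \<Rightarrow> real \<Rightarrow> bool" where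
  "reaction_real p q v \<longleftrightarrow> real_power_defined v p \<and> real_power_defined v q"

definition open_between :: "real \<Rightarrow> real \<Rightarrow> real set" where
  "open_between x y = {min x y <..< max x y}"

text \<open>
  The reaction function need only be assumed real-valued between the equilibria: it is then
  real-valued at the two equilibria as well, see \<open>reaction_real_endpoints\<close>.
\<close>

definition wave_profile ::
  "real \<Rightarrow> real \<Rightarrow> nat \<Rightarrow> real \<Rightarrow> real \<Rightarrow> real \<Rightarrow> real \<Rightarrow> (real \<Rightarrow> real) \<Rightarrow> bool" where
  "wave_profile p q r a c v_minus v_plus V \<longleftrightarrow>
     v_minus \<noteq> v_plus \<and>
     (\<forall>u \<in> open_between v_minus v_plus. reaction_real p q u) \<and>
     reaction p q r a v_minus = 0 \<and> reaction p q r a v_plus = 0 \<and>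
     (\<exists>V' V''. \<forall>z.
        (V has_real_derivative V' z) (at z) \<and>
        (V' has_real_derivative V'' z) (at z) \<and>
        V'' z + c * V' z + reaction p q r a (V z) = 0) \<and>
     (\<forall>z. V z \<in> open_between v_minus v_plus) \<and>
     (V \<longlongrightarrow> v_minus) at_bot \<and> (V \<longlongrightarrow> v_plus) at_top"

lemma reaction_real_endpoints:
  assumes "x \<noteq> y" and "\<forall>u \<in> open_between x y. reaction_real p q u"
  shows "reaction_real p q x" "reaction_real p q y"
proof -
  have "reaction_real p q x \<and> reaction_real p q y"
  proof (cases "0 \<le> min x y")
    case True
    then show ?thesis by (auto simp: reaction_real_def real_power_defined_def)
  next
    case False
    have "min x y < min 0 (max x y)" using False assms(1) by auto
    then obtain u where "min x y < u" "u < min 0 (max x y)" using dense by blast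
    then have "u \<in> open_between x y" "u < 0" by (auto simp: open_between_def)
    with assms(2) show ?thesis
      by (force simp: reaction_real_def real_power_defined_def)
  qed
  then show "reaction_real p q x" "reaction_real p q y" by auto
qed

definition traveling_wave_solution ::
  "real \<Rightarrow> real \<Rightarrow> nat \<Rightarrow> real \<Rightarrow> real \<Rightarrow> real \<Rightarrow> real \<Rightarrow> (real \<Rightarrow> real \<Rightarrow> real) \<Rightarrow> bool" where
  "traveling_wave_solution p q r a c v_minus v_plus v \<longleftrightarrow>
     (\<exists>V. wave_profile p q r a c v_minus v_plus V \<and> (\<forall>\<xi> \<tau>. v \<xi> \<tau> = V (\<xi> - c * \<tau>)))"

lemma traveling_wave_solution_solves_pde:
  assumes "traveling_wave_solution p q r a c v_minus v_plus v"
  obtains v_t v_x v_xx where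
    "\<And>\<xi> \<tau>. ((\<lambda>t. v \<xi> t) has_real_derivative v_t \<xi> \<tau>) (at \<tau>)"
    "\<And>\<xi> \<tau>. ((\<lambda>x. v x \<tau>) has_real_derivative v_x \<xi> \<tau>) (at \<xi>)"
    "\<And>\<xi> \<tau>. ((\<lambda>x. v_x x \<tau>) has_real_derivative v_xx \<xi> \<tau>) (at \<xi>)"
    "\<And>\<xi> \<tau>. v_t \<xi> \<tau> = v_xx \<xi> \<tau> + reaction p q r a (v \<xi> \<tau>)"
proof -
  from assms obtain V V' V'' where v: "\<And>\<xi> \<tau>. v \<xi> \<tau> = V (\<xi> - c * \<tau>)"
    and d1: "\<And>z. (V has_real_derivative V' z) (at z)"
    and d2: "\<And>z. (V' has_real_derivative V'' z) (at z)"
    and ode: "\<And>z. V'' z + c * V' z + reaction p q r a (V z) = 0"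
    unfolding traveling_wave_solution_def wave_profile_def by blast
  show thesis
  proof (rule that[of "\<lambda>\<xi> \<tau>. - c * V' (\<xi> - c * \<tau>)" "\<lambda>\<xi> \<tau>. V' (\<xi> - c * \<tau>)"
        "\<lambda>\<xi> \<tau>. V'' (\<xi> - c * \<tau>)"])
    show "((\<lambda>t. v \<xi> t) has_real_derivative - c * V' (\<xi> - c * \<tau>)) (at \<tau>)" for \<xi> \<tau>
    proof -
      have "((\<lambda>t. \<xi> - c * t) has_real_derivative - c) (at \<tau>)"
        by (auto intro!: derivative_eq_intros)
      from DERIV_chain2[OF d1 this] show ?thesis unfolding v by (simp add: mult.commute)
    qed
    have sh: "((\<lambda>x. x - c * \<tau>) has_real_derivative 1) (at \<xi>)" for \<xi> \<tau>
      by (auto intro!: derivative_eq_intros)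
    show "((\<lambda>x. v x \<tau>) has_real_derivative V' (\<xi> - c * \<tau>)) (at \<xi>)" for \<xi> \<tau>
      using DERIV_chain2[OF d1 sh] unfolding v by simp
    show "((\<lambda>x. V' (x - c * \<tau>)) has_real_derivative V'' (\<xi> - c * \<tau>)) (at \<xi>)" for \<xi> \<tau>
      using DERIV_chain2[OF d2 sh] by simp
    show "- c * V' (\<xi> - c * \<tau>) = V'' (\<xi> - c * \<tau>) + reaction p q r a (v \<xi> \<tau>)" for \<xi> \<tau>
      using ode[of "\<xi> - c * \<tau>"] unfolding v by linarith
  qed
qed

definition sigmoid :: "(real \<Rightarrow> real) \<Rightarrow> bool" where
  "sigmoid \<sigma> \<longleftrightarrow>
     bounded (range \<sigma>) \<and> (\<forall>x. \<exists>d > 0. (\<sigma> has_real_derivative d) (at x))"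

definition output_activation :: "real \<Rightarrow> real \<Rightarrow> real \<Rightarrow> real" where
  "output_activation v_minus v_plus s = v_minus + (v_plus - v_minus) * (1 / (1 + exp (- s)))"

end

theory Submission
  imports Defs
begin

text \<open>
  Pulling the profile \<open>V\<close> back through the output activation gives a continuous function \<open>g\<close>, and
  with \<open>\<omega> = c\<close> only the single variable \<open>z = \<xi> - c * \<tau>\<close> matters, which ranges over a bounded
  interval.  There \<open>g\<close> is uniformly close to a staircase with small jumps; rescaled copies of the
  sigmoid approximate the individual steps up to an arbitrarily small error, except at the two
  steps adjacent to \<open>z\<close>, whose jumps are small.  Since the output activation is Lipschitz,
  approximating \<open>g\<close> suffices.
\<close>

text \<open>The hypotheses on \<open>S\<close> say only that it takes values in [0,1] and tends to 0
  and 1 at the two ends. A copy of \<open>S\<close> centred at \<open>y i\<close> and compressed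
  enough can therefore replace a unit step there, except close to \<open>y i\<close>.\<close>

lemma staircase_approximation:
  fixes g S :: "real \<Rightarrow> real"
  assumes "A < B" and cont: "continuous_on {A..B} g" and "e > 0"
    and S01: "\<And>x. S x \<in> {0..1}"
    and S_low: "\<And>\<eta>. \<eta> > 0 \<Longrightarrow> \<forall>\<^sub>F x in at_bot. S x \<le> \<eta>"
    and S_high: "\<And>\<eta>. \<eta> > 0 \<Longrightarrow> \<forall>\<^sub>F x in at_top. S x \<ge> 1 - \<eta>"
  shows "\<exists>n l y d. \<forall>x\<in>{A..B}. \<bar>g x - (g A + (\<Sum>i = 1..n::nat. d i * S (l * (x - y i))))\<bar> < e"
proof -
  \<comment> \<open>Error budget: one \<open>e'\<close> for \<open>g x\<close> against the nearest
    node on the left, and three for replacing the exact steps by copies of \<open>S\<close>. This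
    makes four in total, so a fifth keeps the bound strict.\<close>
  define e' where "e' = e / 5"
  have "e' > 0" using \<open>e > 0\<close> by (simp add: e'_def)
  have "uniformly_continuous_on {A..B} g"
    by (rule compact_uniformly_continuous[OF cont compact_Icc])
  then obtain \<delta> where "\<delta> > 0"
    and \<delta>: "\<And>x y. x \<in> {A..B} \<Longrightarrow> y \<in> {A..B} \<Longrightarrow> \<bar>y - x\<bar> < \<delta> \<Longrightarrow> \<bar>g y - g x\<bar> < e'"
    using \<open>e' > 0\<close> unfolding uniformly_continuous_on_def dist_real_def by metis
  obtain n :: nat where n: "(B - A) / \<delta> < real n" using reals_Archimedean2 by blast
  moreover have "(B - A) / \<delta> > 0" using \<open>A < B\<close> \<open>\<delta> > 0\<close> by simp
  ultimately have "real n > 0" by linarith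
  then have "n > 0" by simp
  define h where "h = (B - A) / real n"
  have "h > 0" using \<open>A < B\<close> \<open>n > 0\<close> by (simp add: h_def)
  have "h < \<delta>" using n \<open>\<delta> > 0\<close> \<open>n > 0\<close> by (simp add: h_def field_simps)
  have nh: "real n * h = B - A" using \<open>n > 0\<close> by (simp add: h_def)
  define y where "y k = A + real k * h" for k
  have y_in: "y k \<in> {A..B}" if "k \<le> n" for k
  proof -
    have "real k * h \<le> real n * h" using that \<open>h > 0\<close> by (intro mult_right_mono) auto
    then show ?thesis using nh \<open>h > 0\<close> by (simp add: y_def)
  qed
  \<comment> \<open>Jump heights of the staircase. Sums start at index 1, so the truncated
    subtraction at 0 does no harm.\<close>
  define d where "d k = g (y k) - g (y (k - 1))" for k
  have d_small: "\<bar>d k\<bar> \<le> e'" if "k \<in> {1..n}" for k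
  proof -
    have "y k - y (k - 1) = h" using that by (simp add: y_def of_nat_diff algebra_simps)
    then have "\<bar>y k - y (k - 1)\<bar> < \<delta>" using \<open>h < \<delta>\<close> \<open>h > 0\<close> by simp
    then show ?thesis using \<delta>[of "y (k - 1)" "y k"] y_in that unfolding d_def by force
  qed
  have telescope: "(\<Sum>k = 1..j. d k) = g (y j) - g A" for j
    by (induction j) (auto simp: d_def y_def)
  \<comment> \<open>Tolerance 1/n per step: \<open>n\<close> jumps of height at most
    \<open>e'\<close> then contribute at most \<open>e'\<close> altogether.\<close>
  have "1 / real n > 0" using \<open>n > 0\<close> by simp
  then obtain R1 R2 where R1: "\<And>x. x \<le> R1 \<Longrightarrow> S x \<le> 1 / real n"
    and R2: "\<And>x. x \<ge> R2 \<Longrightarrow> S x \<ge> 1 - 1 / real n"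
    using S_low S_high unfolding eventually_at_bot_linorder eventually_at_top_linorder by meson
  \<comment> \<open>Scaled so that a point at least one mesh width \<open>h\<close> away from a node
    is sent past the threshold \<open>R1\<close> or \<open>R2\<close> on its side.\<close>
  define l where "l = (\<bar>R1\<bar> + \<bar>R2\<bar>) / h"
  have "l \<ge> 0" and lh: "l * h = \<bar>R1\<bar> + \<bar>R2\<bar>" using \<open>h > 0\<close> by (auto simp: l_def)
  have "\<bar>g x - (g A + (\<Sum>i = 1..n. d i * S (l * (x - y i))))\<bar> < e" if x: "x \<in> {A..B}" for x
  proof -
    \<comment> \<open>Index of the last node not exceeding \<open>x\<close>; it equals
      \<open>n\<close> when \<open>x = B\<close>.\<close>
    define j where "j = nat \<lfloor>(x - A) / h\<rfloor>"
    have "(x - A) / h \<ge> 0" using x \<open>h > 0\<close> by simp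
    then have "real j \<le> (x - A) / h" "(x - A) / h < real j + 1"
      unfolding j_def by linarith+
    then have j: "y j \<le> x" "x < y j + h"
      using \<open>h > 0\<close> by (auto simp: y_def field_simps)
    have "real j * h \<le> real n * h" using j(1) x nh by (simp add: y_def)
    then have "j \<le> n" using \<open>h > 0\<close> by simp
    have gx: "\<bar>g x - g (y j)\<bar> < e'"
      using \<delta>[of "y j" x] y_in[OF \<open>j \<le> n\<close>] x j \<open>h < \<delta>\<close> by force
    \<comment> \<open>Exact step values at \<open>x\<close>: the jumps up to \<open>j\<close>
      telescope, so the exact staircase has the value \<open>g (y j)\<close> there.\<close>
    define s where "s i = (if i \<le> j then 1 else 0 :: real)" for i
    have "(\<Sum>i = 1..n. d i * s i) = (\<Sum>i = 1..j. d i)"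
      unfolding s_def using \<open>j \<le> n\<close>
      by (intro sum.mono_neutral_cong_right) auto
    then have stair: "g (y j) = g A + (\<Sum>i = 1..n. d i * s i)" using telescope by simp
    have term_le: "\<bar>d i * s i - d i * S (l * (x - y i))\<bar>
        \<le> e' * (1 / real n) + (if i \<in> {j, Suc j} then e' else 0)" if i: "i \<in> {1..n}" for i
    proof -
      have "\<bar>s i - S (l * (x - y i))\<bar> \<le> 1 / real n + (if i \<in> {j, Suc j} then 1 else 0)"
      proof -
        \<comment> \<open>Nodes \<open>j\<close> and \<open>j + 1\<close> may be arbitrarily close
          to \<open>x\<close>, so only the trivial bound 1 is available for them. All other nodes
          are at least \<open>h\<close> away.\<close>
        consider "i \<in> {j, Suc j}" | "i < j" | "i > Suc j" by fastforce
        then show ?thesis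
        proof cases
          case 1
          have "\<bar>s i - S (l * (x - y i))\<bar> \<le> 1" using S01[of "l * (x - y i)"] by (simp add: s_def)
          then have "\<bar>s i - S (l * (x - y i))\<bar> \<le> 1 / real n + 1"
            using \<open>1 / real n > 0\<close> by linarith
          then show ?thesis using 1 by auto
        next
          case 2
          then have "real i + 1 \<le> real j" by linarith
          then have "(real i + 1) * h \<le> real j * h" using \<open>h > 0\<close> by (intro mult_right_mono) auto
          then have "h \<le> x - y i" using j by (simp add: y_def algebra_simps)
          then have "l * h \<le> l * (x - y i)" using \<open>l \<ge> 0\<close> by (rule mult_left_mono)
          then have "R2 \<le> l * (x - y i)" using lh by linarith
          then show ?thesis using R2[of "l * (x - y i)"] S01[of "l * (x - y i)"] 2
            by (auto simp: s_def)
        next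
          case 3
          \<comment> \<open>Two mesh widths beyond \<open>y j\<close> are required because
            \<open>x\<close> may lie almost one width to the right of \<open>y j\<close>.\<close>
          then have "real j + 2 \<le> real i" by linarith
          then have "(real j + 2) * h \<le> real i * h" using \<open>h > 0\<close> by (intro mult_right_mono) auto
          then have "x - y i \<le> - h" using j by (simp add: y_def algebra_simps)
          then have "l * (x - y i) \<le> l * (- h)" using \<open>l \<ge> 0\<close> by (rule mult_left_mono)
          then have "l * (x - y i) \<le> R1" using lh by linarith
          then show ?thesis using R1[of "l * (x - y i)"] S01[of "l * (x - y i)"] 3
            by (auto simp: s_def)
        qed
      qed
      then have le: "\<bar>d i\<bar> * \<bar>s i - S (l * (x - y i))\<bar>
          \<le> e' * (1 / real n + (if i \<in> {j, Suc j} then 1 else 0))"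
        using d_small[OF i] \<open>e' > 0\<close> by (intro mult_mono) auto
      have "\<bar>d i * s i - d i * S (l * (x - y i))\<bar> = \<bar>d i\<bar> * \<bar>s i - S (l * (x - y i))\<bar>"
        by (simp only: right_diff_distrib[of "d i"] abs_mult[symmetric])
      also note le
      also have "e' * (1 / real n + (if i \<in> {j, Suc j} then 1 else 0))
          = e' * (1 / real n) + (if i \<in> {j, Suc j} then e' else 0)"
        by (auto simp: distrib_left)
      finally show ?thesis .
    qed
    have "\<bar>(\<Sum>i = 1..n. d i * s i) - (\<Sum>i = 1..n. d i * S (l * (x - y i)))\<bar>
        \<le> (\<Sum>i = 1..n. \<bar>d i * s i - d i * S (l * (x - y i))\<bar>)"
      unfolding sum_subtractf[symmetric] by (rule sum_abs)
    also have "\<dots> \<le> (\<Sum>i = 1..n. e' * (1 / real n) + (if i \<in> {j, Suc j} then e' else 0))"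
      by (rule sum_mono[OF term_le])
    \<comment> \<open>The intersection is there because \<open>j\<close> may be 0 and
      \<open>Suc j\<close> may exceed \<open>n\<close>; enlarging it to the full pair only adds
      nonnegative terms.\<close>
    also have "\<dots> = e' + (\<Sum>i\<in>{1..n} \<inter> {j, Suc j}. e')"
      using \<open>n > 0\<close> unfolding sum.distrib sum.inter_restrict[OF finite_atLeastAtMost] by simp
    also have "\<dots> \<le> e' + (\<Sum>i\<in>{j, Suc j}. e')"
      using \<open>e' > 0\<close> by (intro add_left_mono sum_mono2) auto
    finally have "\<bar>(\<Sum>i = 1..n. d i * s i) - (\<Sum>i = 1..n. d i * S (l * (x - y i)))\<bar> \<le> 3 * e'"
      by simp
    then show ?thesis using gx stair \<open>e' > 0\<close> unfolding e'_def by linarith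
  qed
  then show ?thesis by blast
qed

lemma sigmoid_strict_mono:
  assumes "sigmoid \<sigma>"
  shows "strict_mono \<sigma>"
  using assms unfolding sigmoid_def strict_mono_def by (meson DERIV_pos_imp_increasing)

text \<open>Normalising \<open>\<sigma>\<close> affinely to infimum 0 and supremum 1 makes the
  staircase construction applicable. Undoing the normalisation changes only the coefficients and an
  additive constant, and one extra unit with inner weight 0 produces that constant.\<close>

lemma universal_approximation:
  fixes \<sigma> g :: "real \<Rightarrow> real"
  assumes mono: "strict_mono \<sigma>" and bdd: "bounded (range \<sigma>)"
    and "A < B" and "continuous_on {A..B} g" and "e > 0"
  shows "\<exists>N \<ge> (1::nat). \<exists>as bs cs.
    \<forall>x\<in>{A..B}. \<bar>g x - (\<Sum>i = 1..N. cs i * \<sigma> (as i * x + bs i))\<bar> < e"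
proof -
  define L where "L = Inf (range \<sigma>)"
  define U where "U = Sup (range \<sigma>)"
  have bdds: "bdd_below (range \<sigma>)" "bdd_above (range \<sigma>)"
    using bdd by (auto intro: bounded_imp_bdd_below bounded_imp_bdd_above)
  have L: "L \<le> \<sigma> x" and U: "\<sigma> x \<le> U" for x
    using bdds by (auto simp: L_def U_def intro: cInf_lower cSup_upper)
  have "\<sigma> 0 < \<sigma> 1" using mono by (simp add: strict_mono_def)
  then have "L < U" using L[of 0] U[of 1] by linarith
  define S where "S x = (\<sigma> x - L) / (U - L)" for x
  have S01: "S x \<in> {0..1}" for x using L U \<open>L < U\<close> by (simp add: S_def)
  have le: "\<sigma> x \<le> \<sigma> z" if "x \<le> z" for x z
    using strict_mono_mono[OF mono] that by (rule monoD)
  have S_low: "\<forall>\<^sub>F x in at_bot. S x \<le> \<eta>" if "\<eta> > 0" for \<eta>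
  proof -
    \<comment> \<open>Some value of \<open>\<sigma>\<close> comes this close to the infimum, and
      monotonicity preserves the bound everywhere to its left.\<close>
    have "Inf (range \<sigma>) < L + \<eta> * (U - L)" using that \<open>L < U\<close> by (simp add: L_def)
    then obtain R where "\<sigma> R < L + \<eta> * (U - L)" using bdds by (auto simp: cInf_less_iff)
    then have "S x \<le> \<eta>" if "x \<le> R" for x
      using le[OF that] \<open>L < U\<close> by (simp add: S_def divide_le_eq)
    then show ?thesis by (auto simp: eventually_at_bot_linorder)
  qed
  have S_high: "\<forall>\<^sub>F x in at_top. S x \<ge> 1 - \<eta>" if "\<eta> > 0" for \<eta>
  proof -
    have "U - \<eta> * (U - L) < Sup (range \<sigma>)" using that \<open>L < U\<close> by (simp add: U_def)
    then obtain R where "U - \<eta> * (U - L) < \<sigma> R" using bdds by (auto simp: less_cSup_iff)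
    then have "S x \<ge> 1 - \<eta>" if "x \<ge> R" for x
      using le[OF that] \<open>L < U\<close> by (simp add: S_def le_divide_eq algebra_simps)
    then show ?thesis by (auto simp: eventually_at_top_linorder)
  qed
  obtain n l y d where approx:
    "\<And>x. x \<in> {A..B} \<Longrightarrow> \<bar>g x - (g A + (\<Sum>i = 1..n::nat. d i * S (l * (x - y i))))\<bar> < e"
    using staircase_approximation[where S = S, OF \<open>A < B\<close> assms(4) \<open>e > 0\<close> S01 S_low S_high] by blast
  \<comment> \<open>The constant unit is \<open>C / \<sigma> b\<close> times
    \<open>\<sigma> b\<close>, which needs a nonzero value; \<open>\<sigma>\<close> takes two
    different values, so they cannot both vanish.\<close>
  obtain b where b: "\<sigma> b \<noteq> 0" using \<open>\<sigma> 0 < \<sigma> 1\<close> by (metis less_irrefl)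
  define C where "C = g A - (\<Sum>i = 1..n. d i * L / (U - L))"
  define as where "as i = (if i \<le> n then l else 0)" for i
  define bs where "bs i = (if i \<le> n then - l * y i else b)" for i
  define cs where "cs i = (if i \<le> n then d i / (U - L) else C / \<sigma> b)" for i
  have "g A + (\<Sum>i = 1..n. d i * S (l * (x - y i)))
      = (\<Sum>i = 1..Suc n. cs i * \<sigma> (as i * x + bs i))" for x
  proof -
    have "(\<Sum>i = 1..Suc n. cs i * \<sigma> (as i * x + bs i))
        = (\<Sum>i = 1..n. cs i * \<sigma> (as i * x + bs i)) + C"
      using b by (simp add: as_def bs_def cs_def)
    also have "(\<Sum>i = 1..n. cs i * \<sigma> (as i * x + bs i))
        = (\<Sum>i = 1..n. d i * S (l * (x - y i)) + d i * L / (U - L))"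
      by (intro sum.cong refl)
        (auto simp: as_def bs_def cs_def S_def right_diff_distrib diff_divide_distrib)
    finally show ?thesis by (simp add: C_def sum.distrib)
  qed
  then have "\<forall>x\<in>{A..B}. \<bar>g x - (\<Sum>i = 1..Suc n. cs i * \<sigma> (as i * x + bs i))\<bar> < e"
    using approx by metis
  then show ?thesis by (intro exI[of _ "Suc n"]) auto
qed

text \<open>Mean value bound: the derivative is at most 1, since \<open>exp (- z)\<close> is
  dominated by the expansion of the squared denominator.\<close>

lemma logistic_lipschitz:
  fixes s t :: real
  shows "\<bar>1 / (1 + exp (- s)) - 1 / (1 + exp (- t))\<bar> \<le> \<bar>s - t\<bar>"
proof -
  have pos: "1 + exp (- z) > 0" for z :: real by (simp add: add_pos_pos)
  have "norm (1 / (1 + exp (- s)) - 1 / (1 + exp (- t))) \<le> 1 * norm (s - t)"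
  proof (rule field_differentiable_bound[where S = UNIV])
    fix z :: real
    show "((\<lambda>z. 1 / (1 + exp (- z))) has_field_derivative exp (- z) / (1 + exp (- z))\<^sup>2)
        (at z within UNIV)"
      using pos[of z] by (auto intro!: derivative_eq_intros simp: power2_eq_square)
    have "exp (- z) \<le> (1 + exp (- z))\<^sup>2"
      by (simp add: power2_eq_square algebra_simps)
    then show "norm (exp (- z) / (1 + exp (- z))\<^sup>2) \<le> 1" using pos[of z] by simp
  qed auto
  then show ?thesis by simp
qed

lemma output_activation_lipschitz:
  "\<bar>output_activation x y s - output_activation x y t\<bar> \<le> \<bar>y - x\<bar> * \<bar>s - t\<bar>"
proof -
  have "output_activation x y s - output_activation x y t
      = (y - x) * (1 / (1 + exp (- s)) - 1 / (1 + exp (- t)))"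
    by (simp add: output_activation_def algebra_simps)
  then show ?thesis
    using mult_left_mono[OF logistic_lipschitz[of s t], of "\<bar>y - x\<bar>"] by (simp add: abs_mult)
qed

text \<open>The logit inverts the output activation on the open interval. If \<open>y < x\<close>,
  numerator and denominator are both negative, so the logarithm has a positive argument for either
  order of the endpoints.\<close>

lemma output_activation_logit:
  assumes "u \<in> open_between x y"
  shows "(u - x) / (y - u) > 0" "output_activation x y (ln ((u - x) / (y - u))) = u"
proof -
  show pos: "(u - x) / (y - u) > 0"
    using assms by (auto simp: open_between_def min_def max_def zero_less_divide_iff split: if_splits)
  have nz: "u \<noteq> x" "u \<noteq> y" "x \<noteq> y"
    using assms by (auto simp: open_between_def)
  have "exp (- ln ((u - x) / (y - u))) = (y - u) / (u - x)"
    using pos by (simp add: exp_minus)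
  moreover have "1 + (y - u) / (u - x) = (y - x) / (u - x)" using nz by (simp add: field_simps)
  ultimately show "output_activation x y (ln ((u - x) / (y - u))) = u"
    using nz by (simp add: output_activation_def)
qed

theorem theorem4p4:
  fixes p q a T c v_minus v_plus :: real
    and r :: nat
    and \<Omega> :: "real set"
    and v w :: "real \<Rightarrow> real \<Rightarrow> real"
    and \<sigma> :: "real \<Rightarrow> real"
  assumes "p > 0" and "q > 0" and "r \<in> {0, 1}" and "a \<in> {0<..<1}"
    and "T > 0" and "compact \<Omega>"
    and "traveling_wave_solution p q r a c v_minus v_plus w"
    and "\<And>\<xi> \<tau>. \<xi> \<in> \<Omega> \<Longrightarrow> \<tau> \<in> {0..T} \<Longrightarrow> v \<xi> \<tau> = w \<xi> \<tau>"
    and "sigmoid \<sigma>"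
  shows "\<forall>\<epsilon> > 0. \<exists>N \<ge> (1::nat). \<exists>(as :: nat \<Rightarrow> real) (bs :: nat \<Rightarrow> real) (cs :: nat \<Rightarrow> real) (\<omega> :: real).
           \<forall>\<xi> \<in> \<Omega>. \<forall>\<tau> \<in> {0..T}.
             \<bar>v \<xi> \<tau> - output_activation v_minus v_plus
                (\<Sum>i = 1..N. cs i * \<sigma> (as i * (\<xi> - \<omega> * \<tau>) + bs i))\<bar> < \<epsilon>"
proof (intro allI impI)
  fix \<epsilon> :: real assume "\<epsilon> > 0"
  from assms(7) obtain V where w: "\<And>\<xi> \<tau>. w \<xi> \<tau> = V (\<xi> - c * \<tau>)"
    and V: "wave_profile p q r a c v_minus v_plus V"
    unfolding traveling_wave_solution_def by blast
  have between: "V z \<in> open_between v_minus v_plus" for z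
    using V by (auto simp: wave_profile_def)
  have V_cont: "continuous_on UNIV V"
    using V unfolding wave_profile_def by (meson DERIV_isCont continuous_at_imp_continuous_on)
  define g where "g z = ln ((V z - v_minus) / (v_plus - V z))" for z
  have g_cont: "continuous_on X g" for X
  proof -
    have "(V z - v_minus) / (v_plus - V z) \<noteq> 0" "v_plus - V z \<noteq> 0" for z
      using output_activation_logit(1)[OF between[of z]] by auto
    then show ?thesis unfolding g_def
      by (intro continuous_intros continuous_on_subset[OF V_cont]) auto
  qed
  have gV: "output_activation v_minus v_plus (g z) = V z" for z
    unfolding g_def by (rule output_activation_logit(2)[OF between])
  obtain M where "M > 0" and M: "\<And>\<xi>. \<xi> \<in> \<Omega> \<Longrightarrow> \<bar>\<xi>\<bar> \<le> M"
    using compact_imp_bounded[OF assms(6)] by (auto simp: bounded_pos)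
  \<comment> \<open>Half-width of an interval containing every value of the wave variable for
    positions in \<open>\<Omega>\<close> and times in [0,T].\<close>
  define B where "B = M + \<bar>c\<bar> * T"
  have "B > 0" using \<open>M > 0\<close> \<open>T > 0\<close> by (simp add: B_def add_pos_nonneg)
  have in_interval: "\<xi> - c * \<tau> \<in> {- B..B}" if "\<xi> \<in> \<Omega>" "\<tau> \<in> {0..T}" for \<xi> \<tau>
  proof -
    have "\<bar>c * \<tau>\<bar> \<le> \<bar>c\<bar> * T" using that by (auto simp: abs_mult intro: mult_left_mono)
    then have "\<bar>\<xi> - c * \<tau>\<bar> \<le> B" using M[OF that(1)] unfolding B_def by linarith
    then show ?thesis by auto
  qed
  \<comment> \<open>Lipschitz constant of the output activation, positive because the equilibria
    differ; hence the tolerance \<open>\<epsilon> / K\<close> for approximating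
    \<open>g\<close>.\<close>
  define K where "K = \<bar>v_plus - v_minus\<bar>"
  have "K > 0" using V by (simp add: K_def wave_profile_def)
  have bdd: "bounded (range \<sigma>)" using assms(9) by (simp add: sigmoid_def)
  have "- B < B" "\<epsilon> / K > 0" using \<open>B > 0\<close> \<open>\<epsilon> > 0\<close> \<open>K > 0\<close> by auto
  from universal_approximation[OF sigmoid_strict_mono[OF assms(9)] bdd this(1) g_cont this(2)]
  obtain N as bs cs where "N \<ge> (1::nat)" and approx:
    "\<And>z. z \<in> {- B..B} \<Longrightarrow> \<bar>g z - (\<Sum>i = 1..N. cs i * \<sigma> (as i * z + bs i))\<bar> < \<epsilon> / K"
    by blast
  \<comment> \<open>The true speed \<open>c\<close> serves as the predicted speed, so the estimate
    in the wave variable transfers directly.\<close>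
  have "\<bar>v \<xi> \<tau> - output_activation v_minus v_plus
          (\<Sum>i = 1..N. cs i * \<sigma> (as i * (\<xi> - c * \<tau>) + bs i))\<bar> < \<epsilon>"
    if "\<xi> \<in> \<Omega>" "\<tau> \<in> {0..T}" for \<xi> \<tau>
  proof -
    let ?z = "\<xi> - c * \<tau>"
    have "\<bar>V ?z - output_activation v_minus v_plus (\<Sum>i = 1..N. cs i * \<sigma> (as i * ?z + bs i))\<bar>
        \<le> K * \<bar>g ?z - (\<Sum>i = 1..N. cs i * \<sigma> (as i * ?z + bs i))\<bar>"
      unfolding gV[symmetric] K_def by (rule output_activation_lipschitz)
    also have "\<dots> < K * (\<epsilon> / K)"
      using \<open>K > 0\<close> approx[OF in_interval[OF that]] by (rule mult_strict_left_mono[rotated])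
    finally show ?thesis using \<open>K > 0\<close> assms(8)[OF that] w by simp
  qed
  then show "\<exists>N \<ge> (1::nat). \<exists>(as :: nat \<Rightarrow> real) (bs :: nat \<Rightarrow> real) (cs :: nat \<Rightarrow> real) (\<omega> :: real).
           \<forall>\<xi> \<in> \<Omega>. \<forall>\<tau> \<in> {0..T}.
             \<bar>v \<xi> \<tau> - output_activation v_minus v_plus
                (\<Sum>i = 1..N. cs i * \<sigma> (as i * (\<xi> - \<omega> * \<tau>) + bs i))\<bar> < \<epsilon>"
    using \<open>N \<ge> 1\<close> by blast
qed

end
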